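(* Let $T$ be a local ring with system of parameters $x_1,\dots,x_s$. For all $t\geq 0$ we have $$(x_1\cdot\ldots\cdot x_s)^t\notin\langle x_1^{st},\dots,x_s^{st}\rangle .$$
   Context: A system of parameters of a local ring $T$ of dimension $s$ is a sequence of $s$ elements of the maximal ideal generating an ideal primary to the maximal ideal. $\langle x_1^{st},\dots,x_s^{st}\rangle$ denotes the ideal of $T$ generated by the listed elements, where the exponent $st$ is the product of $s$ and the integer $t$.
   Formalization: Local rings are Noetherian. The claim is proved for s = 0, or for s ≥ 2 and t ≥ 1; it is false otherwise: if s = 1 then x_1^t is itself the generator, and if t = 0 with s ≥ 1 the ideal contains x_1^0 = 1. *)

theory Defs
  imports "HOL-Algebra.Algebra" "HOL-Library.Extended_Nat"
begin

text \<open>Local rings are Noetherian, as usual in the theory of systems of parameters.\<close>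

locale noetherian_local_ring = cring R + noetherian_ring R for R (structure) +
  assumes ex1_maximalideal: "\<exists>!M. maximalideal M R"

definition max_ideal :: "('a, 'b) ring_scheme \<Rightarrow> 'a set" where
  "max_ideal R = (THE M. maximalideal M R)"

definition radical :: "('a, 'b) ring_scheme \<Rightarrow> 'a set \<Rightarrow> 'a set" where
  "radical R I = {a \<in> carrier R. \<exists>n::nat. a [^]\<^bsub>R\<^esub> n \<in> I}"

locale primary_ideal = ideal I R + cring R for I and R (structure) +
  assumes I_notcarr: "carrier R \<noteq> I"
    and I_primary: "\<lbrakk>a \<in> carrier R; b \<in> carrier R; a \<otimes> b \<in> I; a \<notin> I\<rbrakk>
      \<Longrightarrow> \<exists>n::nat. b [^] n \<in> I"

text \<open>Krull dimension: the supremum of the lengths \<open>n\<close> of chains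
  \<open>P 0 \<subset> \<dots> \<subset> P n\<close> of prime ideals.\<close>

definition krull_dim :: "('a, 'b) ring_scheme \<Rightarrow> enat" where
  "krull_dim R = Sup {enat n | n. \<exists>P. (\<forall>i\<le>n. primeideal (P i) R) \<and> (\<forall>i<n. P i \<subset> P (Suc i))}"

definition system_of_parameters ::
    "('a, 'b) ring_scheme \<Rightarrow> nat \<Rightarrow> (nat \<Rightarrow> 'a) \<Rightarrow> bool" where
  "system_of_parameters R s x \<longleftrightarrow>
     krull_dim R = enat s \<and>
     (\<forall>i\<in>{1..s}. x i \<in> max_ideal R) \<and>
     primary_ideal (Idl\<^bsub>R\<^esub> (x ` {1..s})) R \<and>
     radical R (Idl\<^bsub>R\<^esub> (x ` {1..s})) = max_ideal R"

text \<open>The non-membership of \<open>(x\<^sub>1 \<cdots> x\<^sub>s)\<^sup>t\<close> in the ideal generated by the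
  \<open>(s * t)\<close>-th powers always fails in two degenerate cases: if \<open>s = 1\<close> the
  element is the generator itself, and if \<open>t = 0\<close> with \<open>s > 0\<close> the generators
  are all equal to the unit element.\<close>

lemma (in cring) prod_power_mem_degenerate:
  fixes s t :: nat
  assumes x: "\<And>i. i \<in> {1..s} \<Longrightarrow> x i \<in> carrier R"
    and degenerate: "s = 1 \<or> (0 < s \<and> t = 0)"
  shows "(\<Otimes>i\<in>{1..s}. x i) [^] t \<in> Idl ((\<lambda>i. x i [^] (s * t)) ` {1..s})"
proof -
  have sub: "(\<lambda>i. x i [^] (s * t)) ` {1..s} \<subseteq> carrier R"
    using x by auto
  have "(\<Otimes>i\<in>{1..s}. x i) [^] t = x 1 [^] (s * t)"
    using degenerate
  proof
    assume s: "s = 1"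
    then have "x 1 \<in> carrier R"
      using x by simp
    then show ?thesis
      using s by simp
  next
    assume "0 < s \<and> t = 0"
    then show ?thesis
      by simp
  qed
  moreover have "1 \<in> {1..s}"
    using degenerate by auto
  ultimately have "(\<Otimes>i\<in>{1..s}. x i) [^] t \<in> (\<lambda>i. x i [^] (s * t)) ` {1..s}"
    by blast
  then show ?thesis
    using genideal_self[OF sub] by blast
qed

end

theory Submission
  imports Defs
begin

text \<open>Put \<open>y\<^sub>i = x\<^sub>i\<^sup>t\<close> and suppose \<open>y\<^sub>1 \<cdots> y\<^sub>s = \<Sum> a\<^sub>i y\<^sub>i\<^sup>s\<close>. If some \<open>a\<^sub>j\<close> is a unit,
  then every prime containing the \<open>y\<^sub>i\<close> with \<open>i \<noteq> j\<close> contains \<open>y\<^sub>j\<close> as well. Otherwise \<open>1 - \<Sum> a\<^sub>i\<close> is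
  a unit, and modulo a prime containing all differences \<open>y\<^sub>i - y\<^sub>s\<close> the relation becomes
  \<open>(1 - \<Sum> a\<^sub>i) y\<^sub>s\<^sup>s = 0\<close>, so the prime contains all \<open>y\<^sub>i\<close>. In both cases the maximal ideal is
  minimal over \<open>s - 1\<close> elements, contrary to Krull's height theorem. That theorem is obtained from
  the principal ideal theorem by moving a chain of primes, one generator at a time, into the primes
  containing that generator.\<close>

subsection \<open>Ideals of a localization\<close>

lemma (in cring) ideal_by_closure:
  assumes "I \<subseteq> carrier R" and "\<zero> \<in> I"
    and add: "\<And>a b. \<lbrakk>a \<in> I; b \<in> I\<rbrakk> \<Longrightarrow> a \<oplus> b \<in> I"
    and mult: "\<And>r a. \<lbrakk>r \<in> carrier R; a \<in> I\<rbrakk> \<Longrightarrow> r \<otimes> a \<in> I"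
  shows "ideal I R"
proof (rule idealI)
  show "ring R" ..
  have neg: "\<ominus> a \<in> I" if "a \<in> I" for a
    using mult[of "\<ominus> \<one>" a] that \<open>I \<subseteq> carrier R\<close> by (auto simp: l_minus)
  show "subgroup I (add_monoid R)"
    by (rule add.subgroupI) (use assms neg in \<open>auto simp flip: a_inv_def\<close>)
  show "x \<otimes> a \<in> I" if "a \<in> I" "x \<in> carrier R" for a x
    using mult that by blast
  show "a \<otimes> x \<in> I" if "a \<in> I" "x \<in> carrier R" for a x
    using mult[of x a] that \<open>I \<subseteq> carrier R\<close> by (auto simp: m_comm subset_iff)
qed

lemma (in ideal) diff_closed:
  assumes "a \<in> I" "b \<in> I"
  shows "a \<ominus> b \<in> I"
  using assms by (simp add: a_minus_def a_closed a_inv_closed)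

lemma (in primeideal) mem_of_pow_mem:
  fixes n :: nat
  assumes "a \<in> carrier R" "a [^] n \<in> I"
  shows "a \<in> I"
  using assms(2)
proof (induction n)
  case 0
  then show ?case
    using I_notcarr one_imp_carrier by auto
next
  case (Suc n)
  then show ?case
    using I_prime[of "a [^] n" a] assms(1) by auto
qed

lemma (in ideal) pow_mem:
  fixes n :: nat
  assumes "a \<in> I" "0 < n"
  shows "a [^] n \<in> I"
proof -
  obtain k where n: "n = Suc k"
    using assms(2) gr0_conv_Suc by blast
  have "a [^] k \<in> carrier R"
    using assms(1) Icarr by auto
  then show ?thesis
    using assms(1) I_l_closed unfolding n by simp
qed

lemma (in primeideal) one_notin: "\<one> \<notin> I"
  using I_notcarr one_imp_carrier by auto

text \<open>For a prime \<open>P\<close>, \<open>loc_ideal R P\<close> singles out the ideals contracted from the localization at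
  \<open>P\<close>, and \<open>loc_sum R P J z\<close> is the contraction of the extension of \<open>J + zR\<close>. This replaces the
  construction of the localized ring.\<close>

definition loc_ideal :: "('a, 'b) ring_scheme \<Rightarrow> 'a set \<Rightarrow> 'a set \<Rightarrow> bool" where
  "loc_ideal R P J \<longleftrightarrow> ideal J R \<and>
     (\<forall>s\<in>carrier R - P. \<forall>a\<in>carrier R. s \<otimes>\<^bsub>R\<^esub> a \<in> J \<longrightarrow> a \<in> J)"

definition loc_sum :: "('a, 'b) ring_scheme \<Rightarrow> 'a set \<Rightarrow> 'a set \<Rightarrow> 'a \<Rightarrow> 'a set" where
  "loc_sum R P J z = {a \<in> carrier R. \<exists>s\<in>carrier R - P. \<exists>c\<in>J. \<exists>r\<in>carrier R.
     s \<otimes>\<^bsub>R\<^esub> a = c \<oplus>\<^bsub>R\<^esub> r \<otimes>\<^bsub>R\<^esub> z}"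

lemma loc_idealD:
  assumes "loc_ideal R P J"
  shows "ideal J R"
    and "\<lbrakk>s \<in> carrier R; s \<notin> P; a \<in> carrier R; s \<otimes>\<^bsub>R\<^esub> a \<in> J\<rbrakk> \<Longrightarrow> a \<in> J"
  using assms unfolding loc_ideal_def by auto

lemma loc_sum_mono: "I \<subseteq> J \<Longrightarrow> loc_sum R P I z \<subseteq> loc_sum R P J z"
  unfolding loc_sum_def by blast

lemma loc_sumE:
  assumes "a \<in> loc_sum R P J z"
  obtains s c r where "a \<in> carrier R" "s \<in> carrier R" "s \<notin> P" "c \<in> J" "r \<in> carrier R"
    "s \<otimes>\<^bsub>R\<^esub> a = c \<oplus>\<^bsub>R\<^esub> r \<otimes>\<^bsub>R\<^esub> z"
  using assms unfolding loc_sum_def by blast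

lemma loc_sumI:
  assumes "a \<in> carrier R" "s \<in> carrier R" "s \<notin> P" "c \<in> J" "r \<in> carrier R"
    "s \<otimes>\<^bsub>R\<^esub> a = c \<oplus>\<^bsub>R\<^esub> r \<otimes>\<^bsub>R\<^esub> z"
  shows "a \<in> loc_sum R P J z"
  using assms unfolding loc_sum_def by blast

text \<open>Products of elements outside the prime stay outside it. So two members get the common
  denominator \<open>s t\<close>, and a further factor in front of \<open>a\<close> is absorbed into
  its denominator.\<close>

lemma (in primeideal) loc_ideal_loc_sum:
  assumes "ideal J R" and z: "z \<in> carrier R"
  shows "loc_ideal R I (loc_sum R I J z)"
proof -
  interpret J: ideal J R by fact
  have mult_notin: "s \<otimes> t \<in> carrier R - I"
    if "s \<in> carrier R" "s \<notin> I" "t \<in> carrier R" "t \<notin> I" for s t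
    using that I_prime[of s t] by auto
  have "ideal (loc_sum R I J z) R"
  proof (rule ideal_by_closure)
    show "loc_sum R I J z \<subseteq> carrier R"
      unfolding loc_sum_def by blast
    show "\<zero> \<in> loc_sum R I J z"
      by (rule loc_sumI[of _ _ \<one> _ \<zero> _ \<zero>]) (use one_notin z in auto)
  next
    fix a b
    assume "a \<in> loc_sum R I J z" "b \<in> loc_sum R I J z"
    then obtain s c r t d q where
      a: "a \<in> carrier R" "s \<in> carrier R" "s \<notin> I" "c \<in> J" "r \<in> carrier R" "s \<otimes> a = c \<oplus> r \<otimes> z"
      and b: "b \<in> carrier R" "t \<in> carrier R" "t \<notin> I" "d \<in> J" "q \<in> carrier R" "t \<otimes> b = d \<oplus> q \<otimes> z"
      by (elim loc_sumE) blast
    note carr = a(1,2,5) b(1,2,5) z J.Icarr[OF a(4)] J.Icarr[OF b(4)]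
    have "(s \<otimes> t) \<otimes> (a \<oplus> b) = t \<otimes> (s \<otimes> a) \<oplus> s \<otimes> (t \<otimes> b)"
      using carr by algebra
    also have "\<dots> = (t \<otimes> c \<oplus> s \<otimes> d) \<oplus> (t \<otimes> r \<oplus> s \<otimes> q) \<otimes> z"
      unfolding a(6) b(6) using carr by algebra
    finally show "a \<oplus> b \<in> loc_sum R I J z"
      by (intro loc_sumI[of _ _ "s \<otimes> t" _ "t \<otimes> c \<oplus> s \<otimes> d" _ "t \<otimes> r \<oplus> s \<otimes> q"])
        (use a b mult_notin in \<open>auto intro: J.a_closed J.I_l_closed\<close>)
  next
    fix p a
    assume p: "p \<in> carrier R" and "a \<in> loc_sum R I J z"
    then obtain s c r where
      a: "a \<in> carrier R" "s \<in> carrier R" "s \<notin> I" "c \<in> J" "r \<in> carrier R" "s \<otimes> a = c \<oplus> r \<otimes> z"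
      by (elim loc_sumE)
    note carr = p a(1,2,5) z J.Icarr[OF a(4)]
    have "s \<otimes> (p \<otimes> a) = p \<otimes> (s \<otimes> a)"
      using carr by algebra
    also have "\<dots> = p \<otimes> c \<oplus> (p \<otimes> r) \<otimes> z"
      unfolding a(6) using carr by algebra
    finally show "p \<otimes> a \<in> loc_sum R I J z"
      by (intro loc_sumI[of _ _ s _ "p \<otimes> c" _ "p \<otimes> r"])
        (use a p in \<open>auto intro: J.I_l_closed\<close>)
  qed
  moreover have "a \<in> loc_sum R I J z"
    if "t \<in> carrier R" "t \<notin> I" "a \<in> carrier R" "t \<otimes> a \<in> loc_sum R I J z" for t a
  proof -
    obtain s c r where
      a: "s \<in> carrier R" "s \<notin> I" "c \<in> J" "r \<in> carrier R" "s \<otimes> (t \<otimes> a) = c \<oplus> r \<otimes> z"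
      using \<open>t \<otimes> a \<in> loc_sum R I J z\<close> by (elim loc_sumE)
    then show ?thesis
      by (intro loc_sumI[of _ _ "s \<otimes> t" _ c _ r]) (use that mult_notin m_assoc in auto)
  qed
  ultimately show ?thesis
    unfolding loc_ideal_def by blast
qed

lemma (in primeideal) subset_loc_sum:
  assumes "ideal J R" "z \<in> carrier R"
  shows "J \<subseteq> loc_sum R I J z"
proof
  fix a
  assume "a \<in> J"
  moreover from this have "a \<in> carrier R"
    using ideal.Icarr[OF assms(1)] by blast
  ultimately show "a \<in> loc_sum R I J z"
    by (intro loc_sumI[of _ _ \<one> _ a _ \<zero>]) (use assms(2) one_notin in auto)
qed

lemma (in primeideal) mem_loc_sum:
  assumes "ideal J R" "z \<in> carrier R"
  shows "z \<in> loc_sum R I J z"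
proof -
  interpret J: ideal J R by fact
  show ?thesis
    by (intro loc_sumI[of _ _ \<one> _ \<zero> _ \<one>]) (use assms one_notin in auto)
qed

text \<open>Denominators outside \<open>P\<close> can be cancelled in \<open>L\<close>. For prime
  \<open>P\<close>, together with the preceding lemmas, this makes \<open>loc_sum R P J z\<close>
  the least ideal with \<open>loc_ideal R P\<close> that contains \<open>J\<close> and
  \<open>z\<close>.\<close>

lemma (in cring) loc_sum_subset:
  assumes "loc_ideal R P L" "J \<subseteq> L" "z \<in> L"
  shows "loc_sum R P J z \<subseteq> L"
proof
  interpret L: ideal L R using assms(1) by (rule loc_idealD)
  fix a
  assume "a \<in> loc_sum R P J z"
  then obtain s c r where
    a: "a \<in> carrier R" "s \<in> carrier R" "s \<notin> P" "c \<in> J" "r \<in> carrier R" "s \<otimes> a = c \<oplus> r \<otimes> z"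
    by (elim loc_sumE)
  then have "s \<otimes> a \<in> L"
    using assms(2,3) by (auto intro: L.a_closed L.I_l_closed)
  then show "a \<in> L"
    using a assms(1) loc_idealD(2) by metis
qed

text \<open>In a Noetherian ring a nonempty chain of ideals contains its own union, so Zorn's lemma
  applies to any nonempty set of ideals.\<close>

lemma (in noetherian_ring) exists_maximal_ideal_in:
  assumes "S \<subseteq> {I. ideal I R}" "S \<noteq> {}"
  shows "\<exists>M\<in>S. \<forall>J\<in>S. M \<subseteq> J \<longrightarrow> J = M"
proof (rule subset_Zorn)
  fix C
  assume C: "subset.chain S C"
  show "\<exists>U\<in>S. \<forall>Y\<in>C. Y \<subseteq> U"
  proof (cases "C = {}")
    case True
    then show ?thesis using assms(2) by auto
  next
    case False
    have "subset.chain {I. ideal I R} C"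
      using C assms(1) unfolding subset.chain_def by (meson order_trans)
    then have "\<Union>C \<in> C"
      using ideal_chain_is_trivial False by simp
    moreover from this have "\<Union>C \<in> S"
      using C unfolding subset.chain_def by (meson subsetD)
    ultimately show ?thesis
      by (meson Union_upper)
  qed
qed

subsection \<open>The principal ideal theorem\<close>

locale noetherian_cring = cring R + noetherian_ring R for R (structure)
begin

text \<open>A maximal member among the ideals \<open>(I : a)\<close> with \<open>a\<close> outside
  \<open>I\<close> is prime: if \<open>q a\<close> is outside \<open>I\<close>, then
  \<open>(I : q a)\<close> contains \<open>(I : a)\<close> and so equals it, and
  \<open>p q a\<close> in \<open>I\<close> puts \<open>p\<close> into it.\<close>

lemma exists_associated_prime:
  assumes "ideal I R" "I \<noteq> carrier R"
  shows "\<exists>a\<in>carrier R - I. primeideal {r \<in> carrier R. r \<otimes> a \<in> I} R"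
proof -
  interpret I: ideal I R by fact
  define ann where "ann a = {r \<in> carrier R. r \<otimes> a \<in> I}" for a
  have ideal_ann: "ideal (ann a) R" if "a \<in> carrier R" for a
    unfolding ann_def
    by (rule ideal_by_closure)
      (use that in \<open>auto simp: l_distr m_assoc intro: I.a_closed I.I_l_closed\<close>)
  have "\<one> \<in> carrier R - I"
    using assms(2) I.one_imp_carrier by blast
  then have "\<exists>A\<in>ann ` (carrier R - I). \<forall>B\<in>ann ` (carrier R - I). A \<subseteq> B \<longrightarrow> B = A"
    by (intro exists_maximal_ideal_in) (use ideal_ann in auto)
  then obtain a where a: "a \<in> carrier R" "a \<notin> I"
    and max: "\<And>b. \<lbrakk>b \<in> carrier R; b \<notin> I; ann a \<subseteq> ann b\<rbrakk> \<Longrightarrow> ann b = ann a"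
    by auto
  have "primeideal (ann a) R"
  proof (rule primeidealI)
    show "ideal (ann a) R" using ideal_ann a by blast
    show "cring R" ..
    show "carrier R \<noteq> ann a"
      using a unfolding ann_def by (metis (no_types, lifting) l_one mem_Collect_eq one_closed)
  next
    fix p q
    assume pq: "p \<in> carrier R" "q \<in> carrier R" "p \<otimes> q \<in> ann a"
    show "p \<in> ann a \<or> q \<in> ann a"
    proof (rule disjCI)
      assume "q \<notin> ann a"
      then have "q \<otimes> a \<notin> I"
        using pq unfolding ann_def by blast
      moreover have "ann a \<subseteq> ann (q \<otimes> a)"
      proof
        fix r
        assume "r \<in> ann a"
        then have r: "r \<in> carrier R" "q \<otimes> (r \<otimes> a) \<in> I"
          unfolding ann_def using pq I.I_l_closed by auto
        moreover have "q \<otimes> (r \<otimes> a) = r \<otimes> (q \<otimes> a)"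
          using r a pq by (simp add: m_lcomm)
        ultimately show "r \<in> ann (q \<otimes> a)"
          unfolding ann_def by simp
      qed
      ultimately have "ann (q \<otimes> a) = ann a"
        using max a pq by simp
      moreover have "p \<in> ann (q \<otimes> a)"
        using pq a unfolding ann_def by (auto simp: m_assoc)
      ultimately show "p \<in> ann a" by simp
    qed
  qed
  then show ?thesis
    using a unfolding ann_def by blast
qed

text \<open>Noetherian induction: a maximal bad ideal \<open>M\<close> has an annihilator \<open>(M : a) = P\<close>, so locally
  \<open>(M + aR) / M\<close> is simple and the chain condition passes from \<open>M + aR\<close> to \<open>M\<close>.\<close>

lemma loc_ideals_artinian:
  assumes "primeideal P R" "loc_ideal R P I"
    and minimal: "\<And>Q. \<lbrakk>primeideal Q R; I \<subseteq> Q; Q \<subseteq> P\<rbrakk> \<Longrightarrow> Q = P"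
    and chain: "\<And>n. loc_ideal R P (J n)" "\<And>n. I \<subseteq> J n" "decseq J"
  shows "\<exists>N. \<forall>n\<ge>N. J n = J N"
proof (rule ccontr)
  assume unstable: "\<not> ?thesis"
  interpret P: primeideal P R by fact
  \<comment> \<open>Ideals above \<open>I\<close> over which some descending chain never stabilizes.
    Maximality of \<open>M\<close> will restore the chain condition over every strictly larger ideal
    with \<open>loc_ideal R P\<close>.\<close>
  define bad where "bad = {I'. loc_ideal R P I' \<and> I \<subseteq> I' \<and>
    (\<exists>J. (\<forall>n. loc_ideal R P (J n) \<and> I' \<subseteq> J n) \<and> decseq J \<and> \<not> (\<exists>N. \<forall>n\<ge>N. J n = J N))}"
  have "I \<in> bad"
    unfolding bad_def using assms(2) chain unstable by (intro CollectI conjI exI[of _ J]) auto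
  then have "\<exists>M\<in>bad. \<forall>J\<in>bad. M \<subseteq> J \<longrightarrow> J = M"
    by (intro exists_maximal_ideal_in) (auto simp: bad_def loc_ideal_def)
  then obtain M where M: "M \<in> bad" and max: "\<And>M'. \<lbrakk>M' \<in> bad; M \<subseteq> M'\<rbrakk> \<Longrightarrow> M' = M"
    by blast
  then obtain K where "I \<subseteq> M" and loc_M: "loc_ideal R P M"
    and K: "\<And>n. loc_ideal R P (K n)" "\<And>n. M \<subseteq> K n" "decseq K"
    and unstable_K: "\<not> (\<exists>N. \<forall>n\<ge>N. K n = K N)"
    unfolding bad_def mem_Collect_eq by (elim conjE exE) metis
  interpret M: ideal M R using loc_M by (rule loc_idealD)
  have K_ideal: "ideal (K n) R" for n
    using K(1) by (rule loc_idealD)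
  have "M \<noteq> carrier R"
  proof
    assume "M = carrier R"
    then have "K n = carrier R" for n
      using K(2)[of n] ideal.Icarr[OF K_ideal] by blast
    then show False using unstable_K by simp
  qed
  then obtain a where a: "a \<in> carrier R" "a \<notin> M" and "primeideal {r \<in> carrier R. r \<otimes> a \<in> M} R"
    using exists_associated_prime[OF M.ideal_axioms] by blast
  moreover have "I \<subseteq> {r \<in> carrier R. r \<otimes> a \<in> M}"
    using \<open>I \<subseteq> M\<close> a M.Icarr M.I_r_closed by blast
  \<comment> \<open>An \<open>r\<close> outside \<open>P\<close> could be cancelled from
    \<open>r a\<close>, putting \<open>a\<close> into \<open>M\<close>. As \<open>P\<close> is
    minimal over \<open>I\<close>, the annihilator is then all of \<open>P\<close>.\<close>
  moreover have "{r \<in> carrier R. r \<otimes> a \<in> M} \<subseteq> P"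
    using loc_idealD(2)[OF loc_M] a by blast
  ultimately have ann: "{r \<in> carrier R. r \<otimes> a \<in> M} = P"
    using minimal by blast
  define K' where "K' n = loc_sum R P (K n) a" for n
  have M': "loc_ideal R P (loc_sum R P M a)" "M \<subseteq> loc_sum R P M a" "a \<in> loc_sum R P M a"
    using P.loc_ideal_loc_sum P.subset_loc_sum P.mem_loc_sum M.ideal_axioms a by auto
  then have not_bad: "loc_sum R P M a \<notin> bad"
    using max a by blast
  have K': "\<And>n. loc_ideal R P (K' n)" "\<And>n. loc_sum R P M a \<subseteq> K' n"
    "decseq K'"
    using P.loc_ideal_loc_sum[OF K_ideal a(1)] loc_sum_mono[OF K(2)]
      loc_sum_mono[OF decseqD[OF K(3)]]
    unfolding K'_def decseq_def by blast+
  \<comment> \<open>Adjoining \<open>a\<close> enlarges \<open>M\<close> strictly, so the result is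
    not bad and the enlarged chain \<open>K'\<close> stabilizes.\<close>
  obtain N where N: "\<And>n. n \<ge> N \<Longrightarrow> K' n = K' N"
  proof (rule ccontr)
    assume "\<not> thesis"
    with that have "\<not> (\<exists>N. \<forall>n\<ge>N. K' n = K' N)"
      by blast
    moreover have "I \<subseteq> loc_sum R P M a"
      using \<open>I \<subseteq> M\<close> M'(2) by (rule order_trans)
    ultimately have "loc_sum R P M a \<in> bad"
      unfolding bad_def using K' M'(1) by (intro CollectI conjI exI[of _ K']) auto
    then show False using not_bad by blast
  qed
  \<comment> \<open>If \<open>a\<close> lay in every \<open>K n\<close>, adjoining it would change
    nothing, and \<open>K\<close> would stabilize along with \<open>K'\<close>.\<close>
  have "\<exists>n. a \<notin> K n"
  proof (rule ccontr)
    assume "\<not> ?thesis"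
    then have "K' n = K n" for n
      unfolding K'_def using loc_sum_subset[OF K(1)] P.subset_loc_sum[OF K_ideal a(1)]
      by (simp add: subset_antisym)
    then have "K n = K N" if "n \<ge> N" for n
      using N[OF that] by simp
    then show False using unstable_K by blast
  qed
  then obtain n0 where n0: "a \<notin> K n0" by blast
  \<comment> \<open>From \<open>n0\<close> on the descending chain avoids \<open>a\<close>; from
    \<open>N\<close> on the enlarged chain is constant.\<close>
  define n1 where "n1 = max n0 N"
  have "K n = K n1" if "n \<ge> n1" for n
  proof
    show "K n \<subseteq> K n1"
      using K(3) that by (simp add: decseq_def)
    show "K n1 \<subseteq> K n"
    proof
      interpret n1: ideal "K n1" R by (rule K_ideal)
      interpret n: ideal "K n" R by (rule K_ideal)
      fix b
      assume b: "b \<in> K n1"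
      have "K' n = K' n1"
        using N[of n] N[of n1] that unfolding n1_def by simp
      moreover have "b \<in> K' n1"
        unfolding K'_def using P.subset_loc_sum[OF K_ideal a(1)] b by blast
      ultimately obtain s c r where
        s: "s \<in> carrier R" "s \<notin> P" "c \<in> K n" "r \<in> carrier R" "s \<otimes> b = c \<oplus> r \<otimes> a"
        unfolding K'_def by (metis loc_sumE)
      have carr: "b \<in> carrier R" "c \<in> carrier R"
        using b s n1.Icarr n.Icarr by auto
      have "c \<in> K n1"
        using s(3) \<open>K n \<subseteq> K n1\<close> by blast
      then have "s \<otimes> b \<ominus> c \<in> K n1"
        using b s n1.I_l_closed n1.diff_closed by blast
      moreover have "s \<otimes> b \<ominus> c = r \<otimes> a"
        unfolding s(5) using s a carr by algebra
      moreover have "a \<notin> K n1"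
        using n0 K(3) unfolding n1_def decseq_def by (meson max.cobounded1 subsetD)
      \<comment> \<open>\<open>K n1\<close> contains \<open>r a\<close> but not \<open>a\<close>, so
        \<open>r\<close> cannot be cancelled there. Since \<open>P\<close> annihilates
        \<open>a\<close> modulo \<open>M\<close>, the product \<open>r a\<close> already lies in
        \<open>K n\<close>.\<close>
      ultimately have "r \<in> P"
        using loc_idealD(2)[OF K(1)] s a by metis
      then have "r \<otimes> a \<in> K n"
        using ann K(2) by blast
      then have "s \<otimes> b \<in> K n"
        using s n.a_closed by simp
      then show "b \<in> K n"
        using loc_idealD(2)[OF K(1)] s carr by blast
    qed
  qed
  then show False using unstable_K by blast
qed

text \<open>Nakayama's lemma over the localization at \<open>P\<close>, by the chain condition: with
  \<open>L\<close> maximal among the ideals between \<open>J\<close> and \<open>M\<close> that are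
  strictly smaller than \<open>M\<close>, any \<open>a\<close> in \<open>M\<close> outside
  \<open>L\<close> generates \<open>M\<close> over \<open>L\<close> locally, and \<open>gen\<close>
  then forces \<open>a\<close> into \<open>L\<close>.\<close>

lemma loc_ideal_nakayama:
  assumes "primeideal P R" "loc_ideal R P J" "loc_ideal R P M" "J \<subseteq> M" "z \<in> P"
    and gen: "\<And>a. a \<in> M \<Longrightarrow> \<exists>s\<in>carrier R - P. \<exists>c\<in>J. \<exists>m\<in>M. s \<otimes> a = c \<oplus> m \<otimes> z"
  shows "J = M"
proof (rule ccontr)
  assume "J \<noteq> M"
  interpret P: primeideal P R by fact
  have z: "z \<in> carrier R" using assms(5) P.Icarr by blast
  define S where "S = {L. loc_ideal R P L \<and> J \<subseteq> L \<and> L \<subset> M}"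
  have "\<exists>L\<in>S. \<forall>L'\<in>S. L \<subseteq> L' \<longrightarrow> L' = L"
    by (rule exists_maximal_ideal_in)
      (use assms \<open>J \<noteq> M\<close> in \<open>auto simp: S_def loc_ideal_def\<close>)
  then obtain L where L: "loc_ideal R P L" "J \<subseteq> L" "L \<subset> M"
    and max: "\<And>L'. \<lbrakk>loc_ideal R P L'; L \<subseteq> L'; L' \<subset> M\<rbrakk> \<Longrightarrow> L' = L"
    unfolding S_def by (metis (mono_tags, lifting) mem_Collect_eq order_trans)
  interpret L: ideal L R using L(1) by (rule loc_idealD)
  interpret M: ideal M R using assms(3) by (rule loc_idealD)
  obtain a where a: "a \<in> M" "a \<notin> L" using L(3) by blast
  have a': "a \<in> carrier R" using a M.Icarr by blast
  have "loc_sum R P L a \<subseteq> M"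
    using loc_sum_subset assms(3) L a by blast
  moreover have "loc_ideal R P (loc_sum R P L a)" "L \<subseteq> loc_sum R P L a" "a \<in> loc_sum R P L a"
    using P.loc_ideal_loc_sum P.subset_loc_sum P.mem_loc_sum L.ideal_axioms a' by auto
  ultimately have M_eq: "loc_sum R P L a = M"
    using max a by blast
  obtain s c m where s: "s \<in> carrier R" "s \<notin> P" "c \<in> J" "m \<in> M" "s \<otimes> a = c \<oplus> m \<otimes> z"
    using gen[OF a(1)] by blast
  obtain t d r where t: "t \<in> carrier R" "t \<notin> P" "d \<in> L" "r \<in> carrier R" "t \<otimes> m = d \<oplus> r \<otimes> a"
    using s(4) M_eq by (metis loc_sumE)
  have "c \<in> L" using s L by blast
  note carr = s(1) t(1,4) z a' M.Icarr[OF s(4)] L.Icarr[OF \<open>c \<in> L\<close>] L.Icarr[OF t(3)]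
  \<comment> \<open>Substituting the expression for \<open>m\<close> into the one for
    \<open>a\<close> and collecting the multiples of \<open>a\<close> gives \<open>u a\<close> in
    \<open>L\<close>. As \<open>t s\<close> is outside \<open>P\<close> and \<open>r z\<close>
    inside, \<open>u\<close> is a unit locally.\<close>
  define u where "u = t \<otimes> s \<ominus> r \<otimes> z"
  have "t \<otimes> (s \<otimes> a) = t \<otimes> c \<oplus> (t \<otimes> m) \<otimes> z"
    unfolding s(5) using carr by algebra
  also have "\<dots> = t \<otimes> c \<oplus> z \<otimes> d \<oplus> (r \<otimes> z) \<otimes> a"
    unfolding t(5) using carr by algebra
  finally have eq: "t \<otimes> (s \<otimes> a) = t \<otimes> c \<oplus> z \<otimes> d \<oplus> (r \<otimes> z) \<otimes> a" .
  have "u \<otimes> a = t \<otimes> (s \<otimes> a) \<ominus> (r \<otimes> z) \<otimes> a"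
    unfolding u_def using carr by algebra
  also have "\<dots> = t \<otimes> c \<oplus> z \<otimes> d"
    unfolding eq using carr by algebra
  also have "\<dots> \<in> L"
    using carr \<open>c \<in> L\<close> t L.a_closed L.I_l_closed by blast
  finally have "u \<otimes> a \<in> L" .
  moreover have "u \<notin> P"
  proof
    assume "u \<in> P"
    then have "u \<oplus> r \<otimes> z \<in> P"
      using P.a_closed P.I_l_closed t assms(5) by blast
    moreover have "u \<oplus> r \<otimes> z = t \<otimes> s"
      unfolding u_def using carr by algebra
    ultimately show False
      using P.I_prime s t by metis
  qed
  moreover have "u \<in> carrier R"
    unfolding u_def using carr by simp
  ultimately show False
    using loc_idealD(2)[OF L(1)] a' a by blast
qed

text \<open>A form of Krull's principal ideal theorem: otherwise \<open>P\<close> would be minimal over \<open>Q + zR\<close>. The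
  contractions \<open>J n\<close> of \<open>Q + y\<^sup>n R\<close> from the localization at \<open>P'\<close> stabilize modulo \<open>z\<close> by
  \<open>loc_ideals_artinian\<close>, hence stabilize by Nakayama, since \<open>z \<notin> P'\<close>.\<close>

lemma exists_prime_between:
  assumes "primeideal Q R" "primeideal P' R" "primeideal P R" "Q \<subset> P'" "P' \<subset> P" "z \<in> P"
  shows "\<exists>P''. primeideal P'' R \<and> Q \<subset> P'' \<and> P'' \<subset> P \<and> z \<in> P''"
proof (rule ccontr)
  assume none: "\<not> ?thesis"
  interpret Q: primeideal Q R by fact
  interpret P': primeideal P' R by fact
  interpret P: primeideal P R by fact
  have z: "z \<in> carrier R" using assms(6) P.Icarr by blast
  \<comment> \<open>Otherwise \<open>P'\<close> itself would be the prime sought.\<close>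
  have "z \<notin> P'" using none assms by blast
  obtain y where y: "y \<in> P'" "y \<notin> Q" using assms(4) by blast
  have y': "y \<in> carrier R" using y P'.Icarr by blast
  define I where "I = loc_sum R P Q z"
  have I: "loc_ideal R P I" "Q \<subseteq> I" "z \<in> I"
    unfolding I_def
    using P.loc_ideal_loc_sum P.subset_loc_sum P.mem_loc_sum Q.ideal_axioms z by auto
  have minimal: "P'' = P" if "primeideal P'' R" "I \<subseteq> P''" "P'' \<subseteq> P" for P''
  proof -
    \<comment> \<open>\<open>P''\<close> contains \<open>z\<close>, whereas \<open>Q\<close> lies
      inside \<open>P'\<close> and so does not.\<close>
    have "P'' \<noteq> Q" using that I \<open>z \<notin> P'\<close> assms(4) by blast
    then show ?thesis using none that I by blast
  qed
  define J where "J n = loc_sum R P' Q (y [^] (n::nat))" for n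
  have loc': "loc_ideal R P' (J n)" and QJ: "Q \<subseteq> J n" and yJ: "y [^] n \<in> J n" for n
    unfolding J_def
    using P'.loc_ideal_loc_sum P'.subset_loc_sum P'.mem_loc_sum Q.ideal_axioms y' by auto
  \<comment> \<open>The larger prime \<open>P\<close> leaves fewer denominators to cancel, so the
    property is inherited from \<open>P'\<close>.\<close>
  have loc: "loc_ideal R P (J n)" for n
    using loc'[of n] assms(5) unfolding loc_ideal_def by blast
  have ideal_J: "ideal (J n) R" for n
    using loc by (rule loc_idealD)
  have "J (Suc n) \<subseteq> J n" for n
    unfolding J_def[of "Suc n"]
  proof (rule loc_sum_subset)
    show "loc_ideal R P' (J n)" "Q \<subseteq> J n" by fact+
    show "y [^] Suc n \<in> J n"
      using ideal.I_r_closed[OF ideal_J yJ y'] by simp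
  qed
  then have "decseq J" by (simp add: decseq_Suc_iff)
  define K where "K n = loc_sum R P (J n) z" for n
  have "\<exists>N. \<forall>n\<ge>N. K n = K N"
  proof (rule loc_ideals_artinian)
    show "primeideal P R" "loc_ideal R P I" by fact+
    show "P'' = P" if "primeideal P'' R" "I \<subseteq> P''" "P'' \<subseteq> P" for P''
      using minimal that .
    show "loc_ideal R P (K n)" for n
      unfolding K_def by (rule P.loc_ideal_loc_sum[OF ideal_J z])
    show "I \<subseteq> K n" for n
      unfolding K_def I_def using QJ by (rule loc_sum_mono)
    show "decseq K"
      using \<open>decseq J\<close> unfolding K_def decseq_def by (simp add: loc_sum_mono)
  qed
  then obtain n where "\<And>m. n \<le> m \<Longrightarrow> K m = K n" by blast
  from this[of "Suc n"] have n: "K (Suc n) = K n" by simp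
  have "J (Suc n) = J n"
  proof (rule loc_ideal_nakayama)
    show "primeideal P R" "loc_ideal R P (J (Suc n))" "loc_ideal R P (J n)"
      "J (Suc n) \<subseteq> J n" "z \<in> P" by fact+
    fix a
    assume a: "a \<in> J n"
    interpret Jn: ideal "J n" R by (rule ideal_J)
    have a': "a \<in> carrier R" using a Jn.Icarr by blast
    have "a \<in> K (Suc n)"
      unfolding n unfolding K_def using P.subset_loc_sum[OF ideal_J z] a by blast
    then obtain s c r where
      s: "s \<in> carrier R" "s \<notin> P" "c \<in> J (Suc n)" "r \<in> carrier R" "s \<otimes> a = c \<oplus> r \<otimes> z"
      unfolding K_def by (elim loc_sumE)
    have c: "c \<in> J n" using s(3) \<open>J (Suc n) \<subseteq> J n\<close> by blast
    then have "s \<otimes> a \<ominus> c \<in> J n"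
      by (intro Jn.diff_closed Jn.I_l_closed a s(1))
    moreover have "s \<otimes> a \<ominus> c = z \<otimes> r"
      unfolding s(5) using s z Jn.Icarr[OF c] by algebra
    \<comment> \<open>In \<open>J n\<close> every factor outside \<open>P'\<close> can be cancelled,
      in particular \<open>z\<close>. Thus equality of the \<open>K\<close> becomes
      \<open>J n = J (Suc n) + z J n\<close> locally at \<open>P\<close>.\<close>
    ultimately have "r \<in> J n"
      using loc_idealD(2)[OF loc' z \<open>z \<notin> P'\<close> s(4)] by simp
    with s show "\<exists>s\<in>carrier R - P. \<exists>c\<in>J (Suc n). \<exists>m\<in>J n. s \<otimes> a = c \<oplus> m \<otimes> z"
      by (metis DiffI)
  qed
  then have "y [^] n \<in> loc_sum R P' Q (y [^] Suc n)"
    using yJ[of n] unfolding J_def by simp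
  then obtain s c r where
    s: "s \<in> carrier R" "s \<notin> P'" "c \<in> Q" "r \<in> carrier R"
      "s \<otimes> y [^] n = c \<oplus> r \<otimes> y [^] Suc n"
    by (elim loc_sumE)
  define w where "w = y [^] n"
  have w: "w \<in> carrier R" "w \<notin> Q"
    using y(2) y' Q.mem_of_pow_mem[OF y', of n] unfolding w_def by auto
  have sw: "s \<otimes> w = c \<oplus> r \<otimes> (w \<otimes> y)" using s(5) unfolding w_def by simp
  note carr = s(1,4) w(1) y' Q.Icarr[OF s(3)]
  \<comment> \<open>Modulo \<open>Q\<close> the power \<open>w\<close> cancels, leaving
    \<open>s = r y\<close>. Since \<open>y\<close> is in \<open>P'\<close>, so is \<open>s\<close>,
    which was chosen outside.\<close>
  have "w \<otimes> (s \<ominus> r \<otimes> y) = s \<otimes> w \<ominus> r \<otimes> (w \<otimes> y)"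
    using carr by algebra
  also have "\<dots> = c"
    unfolding sw using carr by algebra
  finally have "w \<otimes> (s \<ominus> r \<otimes> y) \<in> Q" using s by simp
  then have "s \<ominus> r \<otimes> y \<in> Q"
    using Q.I_prime[of w "s \<ominus> r \<otimes> y"] w carr by simp
  then have "(s \<ominus> r \<otimes> y) \<oplus> r \<otimes> y \<in> P'"
    by (intro P'.a_closed P'.I_l_closed y(1) s(4)) (use assms(4) in blast)
  moreover have "(s \<ominus> r \<otimes> y) \<oplus> r \<otimes> y = s"
    using carr by algebra
  ultimately show False using s by simp
qed

end

subsection \<open>The height theorem\<close>

text \<open>Only the ends and the length are recorded, because the primes in between get replaced.
  Chains grow at the upper end, where the replacement starts.\<close>

inductive prime_chain :: "('a, 'b) ring_scheme \<Rightarrow> 'a set \<Rightarrow> nat \<Rightarrow> 'a set \<Rightarrow> bool" for R A where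
  refl: "primeideal A R \<Longrightarrow> prime_chain R A 0 A"
| step: "\<lbrakk>prime_chain R A k B; primeideal C R; B \<subset> C\<rbrakk> \<Longrightarrow> prime_chain R A (Suc k) C"

lemma prime_chain_primeideal_right: "prime_chain R A k B \<Longrightarrow> primeideal B R"
  by (induction rule: prime_chain.induct) auto

lemma prime_chain_primeideal_left: "prime_chain R A k B \<Longrightarrow> primeideal A R"
  by (induction rule: prime_chain.induct) auto

lemma prime_chain_subset: "prime_chain R A k B \<Longrightarrow> A \<subseteq> B"
  by (induction rule: prime_chain.induct) auto

lemma prime_chain_SucE:
  assumes "prime_chain R A (Suc k) C"
  obtains B where "prime_chain R A k B" "primeideal C R" "B \<subset> C"
  using assms by cases auto

lemma prime_chain_psubset: "prime_chain R A (Suc k) B \<Longrightarrow> A \<subset> B"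
  by (elim prime_chain_SucE) (meson prime_chain_subset subset_psubset_trans)

text \<open>By \<open>exists_prime_between\<close>, applied to the top three primes, the one below
  \<open>B\<close> can be replaced by a prime containing \<open>z\<close>; the induction then
  continues on the shorter chain ending there. A chain with a single step shrinks to
  \<open>B\<close> alone.\<close>

lemma (in noetherian_cring) prime_chain_absorb:
  assumes "prime_chain R A (Suc k) B" "z \<in> B"
  shows "\<exists>A'. A \<subseteq> A' \<and> z \<in> A' \<and> prime_chain R A' k B"
  using assms
proof (induction k arbitrary: B)
  case 0
  then have "prime_chain R B 0 B" "A \<subseteq> B"
    by (auto intro: prime_chain.refl prime_chain_primeideal_right dest: prime_chain_subset)
  then show ?case using 0(2) by blast
next
  case (Suc k)
  from Suc.prems(1) obtain C where C: "prime_chain R A (Suc k) C" "primeideal B R" "C \<subset> B"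
    by (rule prime_chain_SucE)
  from C(1) obtain D where D: "prime_chain R A k D" "primeideal C R" "D \<subset> C"
    by (rule prime_chain_SucE)
  obtain C' where C': "primeideal C' R" "D \<subset> C'" "C' \<subset> B" "z \<in> C'"
    using exists_prime_between[OF prime_chain_primeideal_right[OF D(1)] D(2) C(2) D(3) C(3)]
      Suc.prems(2) by blast
  have "prime_chain R A (Suc k) C'"
    using D(1) C'(1,2) by (rule prime_chain.step)
  then obtain A' where "A \<subseteq> A'" "z \<in> A'" "prime_chain R A' k C'"
    using Suc.IH C'(4) by blast
  then show ?case
    using prime_chain.step[OF _ C(2) C'(3)] by blast
qed

text \<open>Each absorption only enlarges the bottom prime, so elements absorbed earlier stay in it,
  at the cost of one step per element. The bound on \<open>card Z\<close> keeps the subtraction from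
  truncating.\<close>

lemma (in noetherian_cring) prime_chain_absorb_finite:
  assumes "finite Z" "prime_chain R A k B" "Z \<subseteq> B" "card Z \<le> k"
  shows "\<exists>A'. Z \<subseteq> A' \<and> prime_chain R A' (k - card Z) B"
  using assms
proof (induction Z rule: finite_induct)
  case empty
  then show ?case by auto
next
  case (insert z Z)
  then obtain A' where A': "Z \<subseteq> A'" "prime_chain R A' (k - card Z) B"
    by auto
  have "k - card Z = Suc (k - card (insert z Z))"
    using insert by simp
  then obtain A'' where "A' \<subseteq> A''" "z \<in> A''" "prime_chain R A'' (k - card (insert z Z)) B"
    using prime_chain_absorb A'(2) insert.prems(2) by (metis insertI1 subsetD)
  then show ?case
    using A'(1) by blast
qed

text \<open>A finite positive supremum of lengths is attained: if \<open>s\<close> were missing,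
  \<open>s - 1\<close> would bound them all.\<close>

lemma krull_dim_chain:
  assumes "krull_dim R = enat s" "0 < s"
  obtains A B where "prime_chain R A s B"
proof -
  define S where
    "S = {enat n | n. \<exists>P. (\<forall>i\<le>n. primeideal (P i) R) \<and> (\<forall>i<n. P i \<subset> P (Suc i))}"
  have Sup: "Sup S = enat s"
    using assms(1) unfolding krull_dim_def S_def .
  have "enat s \<in> S"
  proof (rule ccontr)
    assume notin: "enat s \<notin> S"
    have "e \<le> enat (s - 1)" if "e \<in> S" for e
    proof -
      from that obtain n where n: "e = enat n"
        unfolding S_def by auto
      have "enat n \<le> enat s"
        using that Sup_upper[of e S] unfolding Sup n by simp
      moreover have "n \<noteq> s"
        using notin that n by auto
      ultimately show ?thesis
        unfolding n by simp
    qed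
    then have "Sup S \<le> enat (s - 1)"
      by (rule Sup_least)
    then show False
      using assms(2) unfolding Sup by simp
  qed
  then obtain P where P: "\<And>i. i \<le> s \<Longrightarrow> primeideal (P i) R" "\<And>i. i < s \<Longrightarrow> P i \<subset> P (Suc i)"
    unfolding S_def by auto
  have "prime_chain R (P 0) n (P n)" if "n \<le> s" for n
    using that
  proof (induction n)
    case 0
    then show ?case using P(1) prime_chain.refl by blast
  next
    case (Suc n)
    then show ?case using P by (intro prime_chain.step[of R "P 0" n "P n"]) auto
  qed
  then show thesis using that by blast
qed

section \<open>Local rings and primes strictly below the maximal ideal\<close>

sublocale noetherian_local_ring \<subseteq> noetherian_cring R
  by intro_locales

context noetherian_local_ring
begin

lemma maximalideal_max_ideal: "maximalideal (max_ideal R) R"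
  unfolding max_ideal_def using ex1_maximalideal by (rule theI')

lemma proper_ideal_subset_max_ideal:
  assumes "ideal I R" "I \<noteq> carrier R"
  shows "I \<subseteq> max_ideal R"
proof -
  define S where "S = {J. ideal J R \<and> I \<subseteq> J \<and> J \<noteq> carrier R}"
  have "\<exists>M\<in>S. \<forall>J\<in>S. M \<subseteq> J \<longrightarrow> J = M"
    by (rule exists_maximal_ideal_in) (use assms in \<open>auto simp: S_def\<close>)
  then obtain M where "M \<in> S" and max: "\<And>J. \<lbrakk>J \<in> S; M \<subseteq> J\<rbrakk> \<Longrightarrow> J = M"
    by blast
  then have M: "ideal M R" "I \<subseteq> M" "M \<noteq> carrier R"
    unfolding S_def by auto
  have "maximalideal M R"
  proof (rule maximalidealI)
    show "ideal M R" "carrier R \<noteq> M" using M by auto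
    show "J = M \<or> J = carrier R" if "ideal J R" "M \<subseteq> J" for J
      using max[of J] M(2) that unfolding S_def by auto
  qed
  then have "M = max_ideal R"
    using maximalideal_max_ideal ex1_maximalideal by blast
  then show ?thesis
    using M(2) by simp
qed

text \<open>Krull's height theorem in the form used below. The top of a chain of length
  \<open>s\<close> may be replaced by the maximal ideal; absorbing \<open>Z\<close> then leaves at
  least one strict step, and \<open>Q\<close> is the bottom.\<close>

lemma exists_prime_below_max_ideal:
  assumes "krull_dim R = enat s" "finite Z" "Z \<subseteq> max_ideal R" "card Z < s"
  obtains Q where "primeideal Q R" "Z \<subseteq> Q" "Q \<subset> max_ideal R"
proof -
  obtain A B where AB: "prime_chain R A s B"
    using krull_dim_chain assms(1,4) by (metis gr_implies_not0 neq0_conv)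
  obtain k where k: "s = Suc k"
    using assms(4) by (cases s) auto
  from AB[unfolded k] obtain C where C: "prime_chain R A k C" "primeideal B R" "C \<subset> B"
    by (rule prime_chain_SucE)
  interpret B: primeideal B R by fact
  interpret m: maximalideal "max_ideal R" R by (rule maximalideal_max_ideal)
  have "C \<subset> max_ideal R"
    using C(3) proper_ideal_subset_max_ideal B.ideal_axioms B.I_notcarr by (metis psubset_subset_trans)
  moreover have "primeideal (max_ideal R) R"
    using maximalideal_max_ideal by (rule maximalideal_prime)
  ultimately have "prime_chain R A s (max_ideal R)"
    using C(1) unfolding k by (blast intro: prime_chain.step)
  then obtain Q where Q: "Z \<subseteq> Q" "prime_chain R Q (s - card Z) (max_ideal R)"
    using prime_chain_absorb_finite assms(2-4) by (metis less_imp_le)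
  have "s - card Z = Suc (s - card Z - 1)"
    using assms(4) by simp
  then have "Q \<subset> max_ideal R"
    using Q(2) prime_chain_psubset by metis
  then show thesis
    using that Q prime_chain_primeideal_left by blast
qed

text \<open>A prime contains the radical of every ideal inside it, and the radical of the parameter
  ideal is the maximal ideal.\<close>

lemma max_ideal_subset_prime:
  assumes "system_of_parameters R s x" "primeideal Q R" "\<And>i. i \<in> {1..s} \<Longrightarrow> x i \<in> Q"
  shows "max_ideal R \<subseteq> Q"
proof -
  interpret Q: primeideal Q R by fact
  have "Idl (x ` {1..s}) \<subseteq> Q"
    using assms(3) by (intro genideal_minimal Q.ideal_axioms) auto
  moreover have "a \<in> carrier R \<and> (\<exists>n::nat. a [^] n \<in> Idl (x ` {1..s}))" if "a \<in> max_ideal R" for a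
    using assms(1) that unfolding system_of_parameters_def radical_def by blast
  ultimately show ?thesis
    using Q.mem_of_pow_mem by (meson subsetD subsetI)
qed

end

subsection \<open>Systems of parameters\<close>

lemma (in ideal) finsum_mem:
  assumes "finite A" "\<And>i. i \<in> A \<Longrightarrow> f i \<in> I"
  shows "(\<Oplus>i\<in>A. f i) \<in> I"
  using assms
proof (induction A rule: finite_induct)
  case (insert i A)
  then have "f \<in> A \<rightarrow> carrier R" "f i \<in> carrier R"
    using Icarr by auto
  then show ?case
    using insert by (simp add: a_closed)
qed simp

lemma (in ideal) finsum_diff_mem:
  assumes "finite A" "f \<in> A \<rightarrow> carrier R" "g \<in> A \<rightarrow> carrier R"
    and "\<And>i. i \<in> A \<Longrightarrow> f i \<ominus> g i \<in> I"
  shows "(\<Oplus>i\<in>A. f i) \<ominus> (\<Oplus>i\<in>A. g i) \<in> I"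
  using assms
proof (induction A rule: finite_induct)
  case empty
  then show ?case by (simp add: a_minus_def)
next
  case (insert i A)
  then have carr: "f i \<in> carrier R" "g i \<in> carrier R" "(\<Oplus>i\<in>A. f i) \<in> carrier R"
    "(\<Oplus>i\<in>A. g i) \<in> carrier R"
    by auto
  then have "(f i \<oplus> (\<Oplus>i\<in>A. f i)) \<ominus> (g i \<oplus> (\<Oplus>i\<in>A. g i)) =
      (f i \<ominus> g i) \<oplus> ((\<Oplus>i\<in>A. f i) \<ominus> (\<Oplus>i\<in>A. g i))"
    by algebra
  moreover have "\<dots> \<in> I"
  proof (rule additive_subgroup.a_closed[OF is_additive_subgroup])
    show "f i \<ominus> g i \<in> I"
      using insert.prems(3) by blast
    show "(\<Oplus>i\<in>A. f i) \<ominus> (\<Oplus>i\<in>A. g i) \<in> I"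
      using insert.prems by (intro insert.IH) auto
  qed
  ultimately show ?case
    using insert by simp
qed

lemma (in cring) mult_diff_mem:
  assumes "ideal I R" "a \<in> carrier R" "b \<in> carrier R" "c \<in> carrier R" "d \<in> carrier R"
    and "a \<ominus> b \<in> I" "c \<ominus> d \<in> I"
  shows "a \<otimes> c \<ominus> b \<otimes> d \<in> I"
proof -
  interpret I: ideal I R by fact
  have "a \<otimes> c \<ominus> b \<otimes> d = c \<otimes> (a \<ominus> b) \<oplus> b \<otimes> (c \<ominus> d)"
    using assms(2-5) by algebra
  also have "\<dots> \<in> I"
    using assms by (intro I.a_closed I.I_l_closed)
  finally show ?thesis .
qed

lemma (in cring) finprod_diff_mem:
  assumes "ideal I R" "finite A" "f \<in> A \<rightarrow> carrier R" "c \<in> carrier R"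
    and "\<And>i. i \<in> A \<Longrightarrow> f i \<ominus> c \<in> I"
  shows "(\<Otimes>i\<in>A. f i) \<ominus> c [^] card A \<in> I"
  using assms(2,3,5)
proof (induction A rule: finite_induct)
  case empty
  interpret I: ideal I R by fact
  show ?case by (simp add: a_minus_def r_neg)
next
  case (insert i A)
  then have "(\<Otimes>i\<in>A. f i) \<otimes> f i \<ominus> c [^] card A \<otimes> c \<in> I"
    using assms(1,4) by (intro mult_diff_mem) auto
  then show ?case
    using insert by (simp add: m_comm Pi_def)
qed

lemma (in cring) pow_diff_mem:
  fixes n :: nat
  assumes "ideal I R" "a \<in> carrier R" "c \<in> carrier R" "a \<ominus> c \<in> I"
  shows "a [^] n \<ominus> c [^] n \<in> I"
proof (induction n)
  case 0
  interpret I: ideal I R by fact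
  show ?case by (simp add: a_minus_def r_neg)
next
  case (Suc n)
  then show ?case
    using assms by (simp add: mult_diff_mem)
qed

lemma (in cring) finprod_mem:
  assumes "ideal I R" "finite A" "f \<in> A \<rightarrow> carrier R" "k \<in> A" "f k \<in> I"
  shows "(\<Otimes>i\<in>A. f i) \<in> I"
proof -
  interpret I: ideal I R by fact
  have "(\<Otimes>i\<in>insert k (A - {k}). f i) = f k \<otimes> (\<Otimes>i\<in>A - {k}. f i)"
    using assms by (intro finprod_insert) auto
  also have "\<dots> \<in> I"
    using assms by (intro I.I_r_closed finprod_closed) auto
  finally show ?thesis
    using assms(4) by (simp add: insert_absorb)
qed

lemma (in cring) finprod_pow:
  fixes n :: nat
  assumes "finite A" "f \<in> A \<rightarrow> carrier R"
  shows "(\<Otimes>i\<in>A. f i) [^] n = (\<Otimes>i\<in>A. f i [^] n)"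
  using assms
proof (induction A rule: finite_induct)
  case (insert i A)
  then have "f i \<in> carrier R" "(\<Otimes>i\<in>A. f i) \<in> carrier R" "(\<lambda>i. f i [^] n) \<in> A \<rightarrow> carrier R"
    by auto
  then show ?case
    using insert by (simp add: nat_pow_distrib)
qed simp

text \<open>The linear combinations form an ideal containing the generators. Coefficients are
  indexed by \<open>A\<close> rather than by the image, so coinciding generators keep separate
  coefficients.\<close>

lemma (in cring) mem_genideal_imageE:
  assumes "finite A" "f \<in> A \<rightarrow> carrier R" "u \<in> Idl (f ` A)"
  obtains a where "a \<in> A \<rightarrow> carrier R" "u = (\<Oplus>i\<in>A. a i \<otimes> f i)"
proof -
  define L where "L = {\<Oplus>i\<in>A. a i \<otimes> f i | a. a \<in> A \<rightarrow> carrier R}"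
  have fi: "f i \<in> carrier R" if "i \<in> A" for i
    using assms(2) that by blast
  have L: "(\<Oplus>i\<in>A. a i \<otimes> f i) \<in> L" if "a \<in> A \<rightarrow> carrier R" for a
    using that unfolding L_def by blast
  have "ideal L R"
  proof (rule ideal_by_closure)
    show "L \<subseteq> carrier R"
      unfolding L_def using fi by (auto intro!: finsum_closed)
    have "(\<Oplus>i\<in>A. \<zero> \<otimes> f i) = (\<Oplus>i\<in>A. \<zero>)"
      by (rule finsum_cong') (use fi in auto)
    then show "\<zero> \<in> L"
      using L[of "\<lambda>_. \<zero>"] by simp
  next
    fix u v
    assume "u \<in> L" "v \<in> L"
    then obtain a b where a: "a \<in> A \<rightarrow> carrier R" "u = (\<Oplus>i\<in>A. a i \<otimes> f i)"
      and b: "b \<in> A \<rightarrow> carrier R" "v = (\<Oplus>i\<in>A. b i \<otimes> f i)"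
      unfolding L_def by blast
    have "u \<oplus> v = (\<Oplus>i\<in>A. a i \<otimes> f i \<oplus> b i \<otimes> f i)"
      unfolding a(2) b(2) using fi a(1) b(1) by (intro finsum_addf[symmetric]) auto
    also have "\<dots> = (\<Oplus>i\<in>A. (a i \<oplus> b i) \<otimes> f i)"
      using fi a(1) b(1) by (intro finsum_cong') (auto simp: l_distr Pi_def)
    also have "\<dots> \<in> L"
      using a(1) b(1) by (intro L) auto
    finally show "u \<oplus> v \<in> L" .
  next
    fix r u
    assume r: "r \<in> carrier R" and "u \<in> L"
    then obtain a where a: "a \<in> A \<rightarrow> carrier R" "u = (\<Oplus>i\<in>A. a i \<otimes> f i)"
      unfolding L_def by blast
    have "r \<otimes> u = (\<Oplus>i\<in>A. r \<otimes> (a i \<otimes> f i))"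
      unfolding a(2) using fi a(1) r assms(1) by (intro finsum_rdistr) auto
    also have "\<dots> = (\<Oplus>i\<in>A. (r \<otimes> a i) \<otimes> f i)"
      using fi a(1) r by (intro finsum_cong') (auto simp: m_assoc Pi_def)
    also have "\<dots> \<in> L"
      using a(1) r by (intro L) auto
    finally show "r \<otimes> u \<in> L" .
  qed
  moreover have "f ` A \<subseteq> L"
  proof
    fix v
    assume "v \<in> f ` A"
    then obtain j where j: "j \<in> A" "v = f j" by blast
    have "(\<Oplus>i\<in>A. (if j = i then \<one> else \<zero>) \<otimes> f i) = (\<Oplus>i\<in>A. if j = i then f i else \<zero>)"
      by (rule finsum_cong') (use fi in auto)
    also have "\<dots> = v"
      using finsum_singleton[OF j(1) assms(1,2)] j(2) by simp
    finally show "v \<in> L"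
      using L[of "\<lambda>i. if j = i then \<one> else \<zero>"] by auto
  qed
  ultimately have "Idl (f ` A) \<subseteq> L"
    by (rule genideal_minimal)
  then show thesis
    using assms(3) that unfolding L_def by blast
qed

lemma (in noetherian_local_ring) prod_pow_notin:
  assumes sop: "system_of_parameters R s x" and s: "2 \<le> s" and t: "1 \<le> t"
  shows "(\<Otimes>i\<in>{1..s}. x i) [^] t \<notin> Idl ((\<lambda>i. x i [^] (s * t)) ` {1..s})"
proof
  assume mem: "(\<Otimes>i\<in>{1..s}. x i) [^] t \<in> Idl ((\<lambda>i. x i [^] (s * t)) ` {1..s})"
  interpret m: maximalideal "max_ideal R" R by (rule maximalideal_max_ideal)
  have dim: "krull_dim R = enat s" and xm: "\<And>i. i \<in> {1..s} \<Longrightarrow> x i \<in> max_ideal R"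
    using sop unfolding system_of_parameters_def by auto
  have x: "x i \<in> carrier R" if "i \<in> {1..s}" for i
    using xm that m.Icarr by blast
  define y where "y i = x i [^] t" for i
  have ym: "y i \<in> max_ideal R" and y: "y i \<in> carrier R" if "i \<in> {1..s}" for i
    unfolding y_def using m.pow_mem xm x t that by auto
  \<comment> \<open>Both cases below end here: a prime containing every power \<open>y i\<close>
    contains every \<open>x i\<close>, hence the whole maximal ideal.\<close>
  have False if Q: "primeideal Q R" "Q \<subset> max_ideal R" "\<And>i. i \<in> {1..s} \<Longrightarrow> y i \<in> Q" for Q
  proof -
    interpret Q: primeideal Q R by fact
    have "x i \<in> Q" if "i \<in> {1..s}" for i
      using Q.mem_of_pow_mem[OF x[OF that]] Q(3)[OF that] unfolding y_def by blast
    then show False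
      using max_ideal_subset_prime[OF sop Q(1)] Q(2) by blast
  qed
  note contra = this
  define u where "u = (\<Otimes>i\<in>{1..s}. y i)"
  have u: "u \<in> carrier R"
    unfolding u_def using y by (auto intro: finprod_closed)
  have "(\<Otimes>i\<in>{1..s}. x i) [^] t = u"
    unfolding u_def y_def using x by (intro finprod_pow) auto
  moreover have "(\<lambda>i. x i [^] (s * t)) ` {1..s} = (\<lambda>i. y i [^] s) ` {1..s}"
    unfolding y_def using x by (intro image_cong) (auto simp: nat_pow_pow mult.commute)
  ultimately have "u \<in> Idl ((\<lambda>i. y i [^] s) ` {1..s})"
    using mem by simp
  then obtain a where a: "a \<in> {1..s} \<rightarrow> carrier R" and u_eq: "u = (\<Oplus>i\<in>{1..s}. a i \<otimes> y i [^] s)"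
    by (rule mem_genideal_imageE[rotated 2]) (use y in auto)
  show False
  proof (cases "\<exists>j\<in>{1..s}. a j \<notin> max_ideal R")
    case True
    then obtain j where j: "j \<in> {1..s}" "a j \<notin> max_ideal R" by blast
    have "card (y ` ({1..s} - {j})) < s"
      using card_image_le[of "{1..s} - {j}" y] j(1) s by simp
    then obtain Q where Q: "primeideal Q R" "y ` ({1..s} - {j}) \<subseteq> Q" "Q \<subset> max_ideal R"
      by (rule exists_prime_below_max_ideal[OF dim, rotated 2]) (use ym in auto)
    interpret Q: primeideal Q R by fact
    \<comment> \<open>Some index other than \<open>j\<close>, available because
      \<open>2 <= s\<close>. The factor \<open>y k\<close> puts the whole product \<open>u\<close>
      into \<open>Q\<close>.\<close>
    define k :: nat where "k = (if j = 1 then 2 else 1)"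
    have k: "k \<in> {1..s}" "k \<noteq> j"
      unfolding k_def using s by auto
    then have "y k \<in> Q"
      using Q(2) by blast
    then have "u \<in> Q"
      unfolding u_def by (intro finprod_mem[OF Q.ideal_axioms _ _ k(1)]) (simp_all add: y Pi_def)
    define v where "v = (\<Oplus>i\<in>{1..s} - {j}. a i \<otimes> y i [^] s)"
    have "v \<in> Q"
      unfolding v_def using Q(2) a s by (intro Q.finsum_mem Q.I_l_closed Q.pow_mem) auto
    have aj: "a j \<in> carrier R" "y j \<in> carrier R"
      using a y j by auto
    have "(\<Oplus>i\<in>insert j ({1..s} - {j}). a i \<otimes> y i [^] s) = a j \<otimes> y j [^] s \<oplus> v"
      unfolding v_def by (intro finsum_insert) (use a y aj in \<open>auto simp: Pi_def\<close>)
    then have "u = a j \<otimes> y j [^] s \<oplus> v"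
      unfolding u_eq using j(1) by (simp add: insert_absorb)
    then have "a j \<otimes> y j [^] s = u \<ominus> v"
      using aj Q.Icarr[OF \<open>v \<in> Q\<close>] nat_pow_closed[of "y j" s] by algebra
    then have "a j \<otimes> y j [^] s \<in> Q"
      using Q.diff_closed \<open>u \<in> Q\<close> \<open>v \<in> Q\<close> by simp
    moreover have "a j \<notin> Q"
      using j(2) Q(3) by blast
    ultimately have "y j [^] s \<in> Q"
      using Q.I_prime[of "a j" "y j [^] s"] aj by simp
    then have "y j \<in> Q"
      using Q.mem_of_pow_mem[OF aj(2)] by blast
    then show False
      using contra[OF Q(1,3)] Q(2) by blast
  next
    case False
    \<comment> \<open>Comparing with the last element leaves only \<open>s - 1\<close> differences
      to be put into a prime, few enough for the height theorem.\<close>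
    define c where "c = y s"
    have c: "c \<in> carrier R" "c \<in> max_ideal R"
      unfolding c_def using y ym s by auto
    have card: "card ((\<lambda>i. y i \<ominus> c) ` {1..<s}) < s"
      using card_image_le[of "{1..<s}" "\<lambda>i. y i \<ominus> c"] s by simp
    have subset: "(\<lambda>i. y i \<ominus> c) ` {1..<s} \<subseteq> max_ideal R"
      using m.diff_closed ym c by auto
    obtain Q where
      Q: "primeideal Q R" "(\<lambda>i. y i \<ominus> c) ` {1..<s} \<subseteq> Q" "Q \<subset> max_ideal R"
      by (rule exists_prime_below_max_ideal[OF dim _ subset card]) auto
    interpret Q: primeideal Q R by fact
    have yc: "y i \<ominus> c \<in> Q" if "i \<in> {1..s}" for i
    proof (cases "i = s")
      case True
      then show ?thesis
        using c unfolding c_def by (simp add: a_minus_def r_neg)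
    next
      case False
      then show ?thesis
        using that Q(2) by auto
    qed
    define \<sigma> where "\<sigma> = (\<Oplus>i\<in>{1..s}. a i)"
    have \<sigma>: "\<sigma> \<in> max_ideal R"
      unfolding \<sigma>_def using False by (intro m.finsum_mem) auto
    have \<sigma>': "\<sigma> \<in> carrier R" using \<sigma> m.Icarr by blast
    \<comment> \<open>The number of factors of \<open>u\<close> equals the exponent in the
      generators, so modulo \<open>Q\<close> both sides of the relation become multiples of the same
      power of \<open>c\<close>.\<close>
    have 1: "u \<ominus> c [^] s \<in> Q"
      using finprod_diff_mem[OF Q.ideal_axioms, of "{1..s}" y c] y c yc unfolding u_def by simp
    have "u \<ominus> (\<Oplus>i\<in>{1..s}. a i \<otimes> c [^] s) \<in> Q"
      unfolding u_eq
    proof (rule Q.finsum_diff_mem)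
      fix i
      assume i: "i \<in> {1..s}"
      then show "a i \<otimes> y i [^] s \<ominus> a i \<otimes> c [^] s \<in> Q"
        using a y c yc by (intro mult_diff_mem pow_diff_mem Q.ideal_axioms)
          (auto simp: a_minus_def r_neg Pi_def)
    qed (use a y c in \<open>auto simp: Pi_def\<close>)
    moreover have "(\<Oplus>i\<in>{1..s}. a i \<otimes> c [^] s) = \<sigma> \<otimes> c [^] s"
      unfolding \<sigma>_def using a c by (intro finsum_ldistr[symmetric]) auto
    ultimately have 2: "u \<ominus> \<sigma> \<otimes> c [^] s \<in> Q" by simp
    have "(\<one> \<ominus> \<sigma>) \<otimes> c [^] s = (u \<ominus> \<sigma> \<otimes> c [^] s) \<ominus> (u \<ominus> c [^] s)"
      using u \<sigma>' nat_pow_closed[OF c(1), of s] by algebra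
    then have "(\<one> \<ominus> \<sigma>) \<otimes> c [^] s \<in> Q"
      using 1 2 Q.diff_closed by simp
    \<comment> \<open>No coefficient is a unit in this case, so \<sigma> lies in the maximal ideal,
      and \<open>\<one>\<close> would follow it there.\<close>
    moreover have "\<one> \<ominus> \<sigma> \<notin> max_ideal R"
    proof
      assume "\<one> \<ominus> \<sigma> \<in> max_ideal R"
      then have "(\<one> \<ominus> \<sigma>) \<oplus> \<sigma> \<in> max_ideal R"
        using \<sigma> m.a_closed by blast
      moreover have "(\<one> \<ominus> \<sigma>) \<oplus> \<sigma> = \<one>"
        using \<sigma>' by algebra
      ultimately show False
        using m.one_imp_carrier m.I_notcarr by simp
    qed
    then have "\<one> \<ominus> \<sigma> \<notin> Q"
      using Q(3) by blast
    ultimately have "c [^] s \<in> Q"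
      using Q.I_prime[of "\<one> \<ominus> \<sigma>" "c [^] s"] \<sigma>' c by simp
    then have "c \<in> Q"
      using Q.mem_of_pow_mem[OF c(1)] by blast
    have "y i \<in> Q" if "i \<in> {1..s}" for i
    proof -
      have "(y i \<ominus> c) \<oplus> c \<in> Q"
        using yc that \<open>c \<in> Q\<close> Q.a_closed by blast
      moreover have "(y i \<ominus> c) \<oplus> c = y i"
        using y[OF that] c by algebra
      ultimately show ?thesis by simp
    qed
    then show False
      using contra[OF Q(1,3)] by blast
  qed
qed

text \<open>The last assumption excludes exactly \<open>s = 1\<close> and \<open>t = 0\<close> with
  \<open>0 < s\<close>, the cases where \<open>prod_power_mem_degenerate\<close> gives
  membership.\<close>

theorem theorem3p2:
  fixes T (structure) and x :: "nat \<Rightarrow> 'a" and s t :: nat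
  assumes "noetherian_local_ring T"
    and "system_of_parameters T s x"
    and "s = 0 \<or> (2 \<le> s \<and> 1 \<le> t)"
  shows "(\<Otimes>i\<in>{1..s}. x i) [^] t \<notin> Idl ((\<lambda>i. x i [^] (s * t)) ` {1..s})"
proof -
  interpret noetherian_local_ring T by fact
  show ?thesis
  proof (cases "s = 0")
    case True
    interpret m: maximalideal "max_ideal T" T by (rule maximalideal_max_ideal)
    \<comment> \<open>Without parameters the ideal is zero and the empty product is
      \<open>\<one>\<close>, which is nonzero because the maximal ideal is proper.\<close>
    have "Idl {} \<subseteq> {\<zero>}"
      by (intro genideal_minimal zeroideal) simp
    moreover have "\<one> \<noteq> \<zero>"
      using m.one_imp_carrier m.I_notcarr m.zero_closed by metis
    ultimately show ?thesis
      using True by auto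
  next
    case False
    then show ?thesis
      using prod_pow_notin assms(2,3) by blast
  qed
qed

end
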